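(* $\mathfrak{D}$ is a maximal abelian subalgebra of $\mathfrak{I}$; that is, $\mathfrak{D}$ is a commutative $C^*$-subalgebra of $\mathfrak{I}$ that is not properly contained in any commutative subalgebra of $\mathfrak{I}$.
   Context: $\mathfrak{B}$ is the universal unital $C^*$-algebra generated by elements $\{b_i : i\in\mathbb{Z}\}$ (with $b_i^\dagger:=b_i^*$) satisfying, for all $i,j\in\mathbb{Z}$, the monotone rules: (1) $b_ib_j=0$ if $i\le j$; (2) $b_ib_jb_j^\dagger=\alpha_{i,j}b_i$; (3) $b_i^\dagger b_i=b_{i-1}b_{i-1}^\dagger-b_ib_i^\dagger$; (4) $b_ib_i^\dagger b_j=b_j-\alpha_{i,j}\sum_{j<k\le i}b_k^\dagger b_kb_j$; where $\alpha_{i,j}=1$ if $i>j$ and $0$ otherwise. Equivalently, $\mathfrak{B}$ is identified, via $b_i\mapsto a_i$, with the unital $C^*$-algebra of operators generated by $\{a_i:i\in\mathbb{Z}\}$ on the monotone Fock space, i.e. the Hilbert space with orthonormal basis consisting of $\Omega$ and $e_{(i_1,\dots,i_k)}$ ($k\ge1$, $i_1<\cdots<i_k$ integers), where $a_i\Omega=0$ and $a_ie_{(i_1,\dots,i_k)}=e_{(i_2,\dots,i_k)}$ if $i=i_1$ (this being $\Omega$ when $k=1$), and $0$ otherwise. $\mathfrak{I}$ is the $C^*$-subalgebra of $\mathfrak{B}$ generated by $\{b_i : i\in\mathbb{Z}\}$ without adjoining the unit of $\mathfrak{B}$, and $\mathfrak{B}_n:=C^*(\{b_i : |i|\le n\})\subset\mathfrak{I}$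 ($n\ge 0$) is likewise generated without adjoining the unit. Let $V_n$ be the $2^{2n+1}$-dimensional span of $\Omega$ and the vectors $e_{(i_1,\dots,i_k)}$ with all indices in $\{j\in\mathbb{Z} : |j|\le n\}$. $V_n$ is invariant under $\mathfrak{B}_n$ (acting on the monotone Fock space), and restriction to $V_n$ gives a $*$-isomorphism $\mathfrak{B}_n\cong\mathcal{B}(V_n)\cong M_{2^{2n+1}}(\mathbb{C})$, matrices being taken with respect to the orthonormal basis of $V_n$ consisting of $\Omega$ and the vectors $e_{(i_1,\dots,i_k)}$ with $k\ge1$, $i_1<\cdots<i_k$ and all indices in $\{j\in\mathbb{Z} : |j|\le n\}$. $\mathfrak{D}_n\subset\mathfrak{B}_n$ is the subalgebra corresponding to the diagonal matrices; one has $\mathfrak{D}_n\subset\mathfrak{D}_{n+1}$, and $\mathfrak{D}\subset\mathfrak{I}$ is the inductive limit of the $\mathfrak{D}_n$, i.e. the norm closure of $\bigcup_n\mathfrak{D}_n$. *)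

theory Defs
  imports "HOL-Analysis.Analysis"
begin

section \<open>The complex Hilbert space of square-summable families\<close>

typedef 'a ell2 = "{f :: 'a \<Rightarrow> complex. (\<lambda>i. (cmod (f i))\<^sup>2) summable_on UNIV}"
  morphisms coord Abs_ell2
  by (rule exI[of _ "\<lambda>_. 0"]) simp

setup_lifting type_definition_ell2

lemma coord_summable: "(\<lambda>i. (cmod (coord x i))\<^sup>2) summable_on UNIV"
  using coord[of x] by simp

lemma ell2_eqI: "(\<And>i. coord x i = coord y i) \<Longrightarrow> x = y"
  by (simp add: coord_inject[symmetric] fun_eq_iff)

lemma square_summable_add:
  fixes f g :: "'a \<Rightarrow> complex"
  assumes "(\<lambda>i. (cmod (f i))\<^sup>2) summable_on UNIV" "(\<lambda>i. (cmod (g i))\<^sup>2) summable_on UNIV"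
  shows "(\<lambda>i. (cmod (f i + g i))\<^sup>2) summable_on UNIV"
proof (rule summable_on_comparison_test)
  show "(\<lambda>i. 2 * (cmod (f i))\<^sup>2 + 2 * (cmod (g i))\<^sup>2) summable_on UNIV"
    by (intro summable_on_add summable_on_cmult_right assms)
  show "(cmod (f i + g i))\<^sup>2 \<le> 2 * (cmod (f i))\<^sup>2 + 2 * (cmod (g i))\<^sup>2" for i
  proof -
    have "(cmod (f i + g i))\<^sup>2 \<le> (cmod (f i) + cmod (g i))\<^sup>2"
      by (intro power_mono norm_triangle_ineq) auto
    also have "\<dots> \<le> 2 * (cmod (f i))\<^sup>2 + 2 * (cmod (g i))\<^sup>2"
      using sum_squares_bound[of "cmod (f i)" "cmod (g i)"] by (simp add: power2_sum)
    finally show ?thesis .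
  qed
qed auto

lemma square_summable_mult:
  fixes f :: "'a \<Rightarrow> complex"
  assumes "(\<lambda>i. (cmod (f i))\<^sup>2) summable_on UNIV"
  shows "(\<lambda>i. (cmod (c * f i))\<^sup>2) summable_on UNIV"
  using summable_on_cmult_right[OF assms, of "(cmod c)\<^sup>2"]
  by (simp add: norm_mult power_mult_distrib)

lift_definition cscale :: "complex \<Rightarrow> 'a ell2 \<Rightarrow> 'a ell2" is "\<lambda>c f i. c * f i"
  by (rule square_summable_mult)

(* Conjugate-linear in the first and linear in the second argument. *)
definition cinner :: "'a ell2 \<Rightarrow> 'a ell2 \<Rightarrow> complex" where
  "cinner x y = (\<Sum>\<^sub>\<infinity>i. cnj (coord x i) * coord y i)"

lemma cinner_summable: "(\<lambda>i. cnj (coord x i) * coord y i) summable_on UNIV"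
proof (rule abs_summable_summable, rule summable_on_comparison_test)
  show "(\<lambda>i. (cmod (coord x i))\<^sup>2 + (cmod (coord y i))\<^sup>2) summable_on UNIV"
    by (intro summable_on_add coord_summable)
  show "norm (cnj (coord x i) * coord y i) \<le> (cmod (coord x i))\<^sup>2 + (cmod (coord y i))\<^sup>2" for i
  proof -
    have "0 \<le> cmod (coord x i) * cmod (coord y i)" by simp
    then show ?thesis
      using sum_squares_bound[of "cmod (coord x i)" "cmod (coord y i)"]
      unfolding norm_mult complex_mod_cnj by linarith
  qed
qed auto

instantiation ell2 :: (type) real_inner
begin

lift_definition zero_ell2 :: "'a ell2" is "\<lambda>_. 0" by simp
lift_definition plus_ell2 :: "'a ell2 \<Rightarrow> 'a ell2 \<Rightarrow> 'a ell2" is "\<lambda>f g i. f i + g i"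
  by (rule square_summable_add)
lift_definition uminus_ell2 :: "'a ell2 \<Rightarrow> 'a ell2" is "\<lambda>f i. - f i" by simp
lift_definition minus_ell2 :: "'a ell2 \<Rightarrow> 'a ell2 \<Rightarrow> 'a ell2" is "\<lambda>f g i. f i - g i"
  by (drule square_summable_add[where g = "\<lambda>i. - g i" for g]; simp)

definition scaleR_ell2 :: "real \<Rightarrow> 'a ell2 \<Rightarrow> 'a ell2" where
  "scaleR_ell2 r x = cscale (complex_of_real r) x"
definition inner_ell2 :: "'a ell2 \<Rightarrow> 'a ell2 \<Rightarrow> real" where
  "inner_ell2 x y = Re (cinner x y)"
definition norm_ell2 :: "'a ell2 \<Rightarrow> real" where
  "norm_ell2 x = sqrt (\<Sum>\<^sub>\<infinity>i. (cmod (coord x i))\<^sup>2)"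
definition dist_ell2 :: "'a ell2 \<Rightarrow> 'a ell2 \<Rightarrow> real" where
  "dist_ell2 x y = norm (x - y)"
definition sgn_ell2 :: "'a ell2 \<Rightarrow> 'a ell2" where
  "sgn_ell2 x = scaleR (inverse (norm x)) x"
definition uniformity_ell2 :: "('a ell2 \<times> 'a ell2) filter" where
  "uniformity_ell2 = (INF e\<in>{0<..}. principal {(x, y). dist x y < e})"
definition open_ell2 :: "'a ell2 set \<Rightarrow> bool" where
  "open_ell2 S \<longleftrightarrow> (\<forall>x\<in>S. \<forall>\<^sub>F (x', y) in uniformity. x' = x \<longrightarrow> y \<in> S)"

lemma re_cinner: "inner x y = (\<Sum>\<^sub>\<infinity>i. inner (coord x i) (coord y i))"
proof -
  have "Re (cinner x y) = (\<Sum>\<^sub>\<infinity>i. Re (cnj (coord x i) * coord y i))"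
    unfolding cinner_def by (rule infsum_Re[symmetric]) (rule cinner_summable)
  then show ?thesis
    by (simp add: inner_ell2_def inner_complex_def)
qed

lemma re_cinner_summable: "(\<lambda>i. inner (coord x i) (coord y i)) summable_on UNIV"
  using summable_on_Re[OF cinner_summable[of x y]] by (simp add: inner_complex_def)

instance
proof
  fix x y z :: "'a ell2" and r s :: real
  show "x + y + z = x + (y + z)" by transfer (simp add: add.assoc)
  show "x + y = y + x" by transfer (simp add: add.commute)
  show "0 + x = x" by transfer simp
  show "- x + x = 0" by transfer simp
  show "x - y = x + - y" by transfer simp
  show "r *\<^sub>R (x + y) = r *\<^sub>R x + r *\<^sub>R y"
    unfolding scaleR_ell2_def by transfer (simp add: distrib_left)
  show "(r + s) *\<^sub>R x = r *\<^sub>R x + s *\<^sub>R x"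
    unfolding scaleR_ell2_def by transfer (simp add: distrib_right)
  show "r *\<^sub>R s *\<^sub>R x = (r * s) *\<^sub>R x"
    unfolding scaleR_ell2_def by transfer (simp add: mult.assoc)
  show "1 *\<^sub>R x = x"
    unfolding scaleR_ell2_def by transfer simp
  show "dist x y = norm (x - y)" by (rule dist_ell2_def)
  show "sgn x = scaleR (inverse (norm x)) x" by (rule sgn_ell2_def)
  show "uniformity = (INF e\<in>{0<..}. principal {(x :: 'a ell2, y). dist x y < e})"
    by (rule uniformity_ell2_def)
  show "open S \<longleftrightarrow> (\<forall>x\<in>S. \<forall>\<^sub>F (x', y) in uniformity. x' = x \<longrightarrow> y \<in> S)" for S :: "'a ell2 set"
    by (rule open_ell2_def)
  show "inner x y = inner y x"
    by (simp add: re_cinner inner_commute)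
  have "coord (x + y) = (\<lambda>i. coord x i + coord y i)" by (rule plus_ell2.rep_eq)
  then show "inner (x + y) z = inner x z + inner y z"
    using infsum_add[OF re_cinner_summable[of x z] re_cinner_summable[of y z]]
    by (simp add: re_cinner inner_add_left)
  have "coord (r *\<^sub>R x) = (\<lambda>i. r *\<^sub>R coord x i)"
    by (simp add: scaleR_ell2_def cscale.rep_eq scaleR_conv_of_real)
  then show "inner (r *\<^sub>R x) y = r * inner x y"
    by (simp only: re_cinner inner_scaleR_left)
       (simp add: infsum_cmult_right' del: inner_complex_def)
  have xx: "inner x x = (\<Sum>\<^sub>\<infinity>i. (cmod (coord x i))\<^sup>2)"
    by (simp add: re_cinner power2_norm_eq_inner)
  show "0 \<le> inner x x"
    unfolding xx by (rule infsum_nonneg) simp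
  show "inner x x = 0 \<longleftrightarrow> x = 0"
  proof
    assume "inner x x = 0"
    then have "(cmod (coord x i))\<^sup>2 = 0" for i
      unfolding xx by (intro nonneg_infsum_le_0D[OF _ coord_summable]) auto
    then show "x = 0" by (intro ell2_eqI) (simp add: zero_ell2.rep_eq)
  next
    assume "x = 0"
    then show "inner x x = 0" unfolding xx by (simp add: zero_ell2.rep_eq)
  qed
  show "norm x = sqrt (inner x x)"
    by (simp add: norm_ell2_def xx)
qed

end

lemmas coord_simps [simp] = zero_ell2.rep_eq plus_ell2.rep_eq uminus_ell2.rep_eq
  minus_ell2.rep_eq cscale.rep_eq

lemma norm_ell2_square: "(norm x)\<^sup>2 = (\<Sum>\<^sub>\<infinity>i. (cmod (coord x i))\<^sup>2)"
  unfolding norm_ell2_def by (simp add: infsum_nonneg)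

lemma sum_coord_le: "finite F \<Longrightarrow> (\<Sum>i\<in>F. (cmod (coord x i))\<^sup>2) \<le> (norm x)\<^sup>2"
  unfolding norm_ell2_square by (rule finite_sum_le_infsum[OF coord_summable]) auto

lemma norm_coord_le: "cmod (coord x i) \<le> norm x"
  using sum_coord_le[of "{i}" x] by (auto intro: power2_le_imp_le)

lemma norm_ell2_leI:
  assumes "\<And>F. finite F \<Longrightarrow> (\<Sum>i\<in>F. (cmod (coord x i))\<^sup>2) \<le> b\<^sup>2" "b \<ge> 0"
  shows "norm x \<le> b"
proof (rule power2_le_imp_le)
  show "(norm x)\<^sup>2 \<le> b\<^sup>2"
    unfolding norm_ell2_square by (rule infsum_le_finite_sums[OF coord_summable]) (use assms in auto)
qed fact

lemma coord_sum: "coord (sum f F) i = (\<Sum>j\<in>F. coord (f j) i)"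
  by (induction F rule: infinite_finite_induct) auto

instance ell2 :: (type) banach
proof
  fix X :: "nat \<Rightarrow> 'a ell2"
  assume X: "Cauchy X"
  have "Cauchy (\<lambda>n. coord (X n) i)" for i
  proof (rule CauchyI)
    fix e :: real assume "e > 0"
    then obtain M where "\<forall>m\<ge>M. \<forall>n\<ge>M. norm (X m - X n) < e"
      using X CauchyD by blast
    then show "\<exists>M. \<forall>m\<ge>M. \<forall>n\<ge>M. norm (coord (X m) i - coord (X n) i) < e"
      using norm_coord_le[of "X m - X n" i for m n] by (simp) (meson le_less_trans)
  qed
  then obtain f where f: "\<And>i. (\<lambda>n. coord (X n) i) \<longlonglongrightarrow> f i"
    unfolding Cauchy_convergent_iff convergent_def by metis
  have tail: "(\<Sum>i\<in>F. (cmod (coord (X m) i - f i))\<^sup>2) \<le> e\<^sup>2"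
    if "\<forall>m\<ge>M. \<forall>n\<ge>M. norm (X m - X n) < e" "m \<ge> M" "finite F" for M m e F
  proof (rule LIMSEQ_le_const2)
    show "(\<lambda>n. \<Sum>i\<in>F. (cmod (coord (X m) i - coord (X n) i))\<^sup>2)
        \<longlonglongrightarrow> (\<Sum>i\<in>F. (cmod (coord (X m) i - f i))\<^sup>2)"
      by (intro tendsto_intros f)
    show "\<exists>N. \<forall>n\<ge>N. (\<Sum>i\<in>F. (cmod (coord (X m) i - coord (X n) i))\<^sup>2) \<le> e\<^sup>2"
    proof (intro exI allI impI)
      fix n assume "n \<ge> M"
      have "(\<Sum>i\<in>F. (cmod (coord (X m) i - coord (X n) i))\<^sup>2) \<le> (norm (X m - X n))\<^sup>2"
        using sum_coord_le[OF \<open>finite F\<close>, of "X m - X n"] by simp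
      also have "\<dots> \<le> e\<^sup>2"
        using that \<open>n \<ge> M\<close> by (intro power_mono) (auto intro: less_imp_le)
      finally show "(\<Sum>i\<in>F. (cmod (coord (X m) i - coord (X n) i))\<^sup>2) \<le> e\<^sup>2" .
    qed
  qed
  have mem: "(\<lambda>i. (cmod (f i))\<^sup>2) summable_on UNIV"
  proof -
    obtain M where M: "\<forall>m\<ge>M. \<forall>n\<ge>M. norm (X m - X n) < 1"
      using X CauchyD zero_less_one by blast
    have "(\<lambda>i. (cmod (f i - coord (X M) i))\<^sup>2) summable_on UNIV"
      by (rule nonneg_bdd_above_summable_on)
         (use tail[OF M order_refl] in \<open>auto simp: bdd_above_def norm_minus_commute intro!: exI[of _ 1]\<close>)
    from square_summable_add[OF this coord_summable[of "X M"]] show ?thesis by simp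
  qed
  define x where "x = Abs_ell2 f"
  have x: "coord x = f" unfolding x_def using mem by (simp add: Abs_ell2_inverse)
  have "X \<longlonglongrightarrow> x"
  proof (rule LIMSEQ_I)
    fix e :: real assume "e > 0"
    then obtain M where M: "\<forall>m\<ge>M. \<forall>n\<ge>M. norm (X m - X n) < e / 2"
      using X CauchyD half_gt_zero by blast
    have "norm (X m - x) \<le> e / 2" if "m \<ge> M" for m
      by (rule norm_ell2_leI) (use tail[OF M that] \<open>e > 0\<close> in \<open>auto simp: x\<close>)
    then show "\<exists>no. \<forall>n\<ge>no. norm (X n - x) < e"
      using \<open>e > 0\<close> by (intro exI[of _ M]) force
  qed
  then show "convergent X" by (auto simp: convergent_def)
qed

lemma cinner_add_left: "cinner (x + y) z = cinner x z + cinner y z"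
  unfolding cinner_def using infsum_add[OF cinner_summable[of x z] cinner_summable[of y z]]
  by (simp add: distrib_right)

lemma cinner_add_right: "cinner x (y + z) = cinner x y + cinner x z"
  unfolding cinner_def using infsum_add[OF cinner_summable[of x y] cinner_summable[of x z]]
  by (simp add: distrib_left)

lemma cinner_cscale_left [simp]: "cinner (cscale c x) y = cnj c * cinner x y"
  unfolding cinner_def by (simp add: mult.assoc infsum_cmult_right')

lemma cinner_cscale_right [simp]: "cinner x (cscale c y) = c * cinner x y"
  unfolding cinner_def by (simp add: mult.left_commute infsum_cmult_right')

lemma cinner_commute: "cinner x y = cnj (cinner y x)"
  unfolding cinner_def infsum_cnj[symmetric] by (simp add: mult.commute)

lemma cinner_self: "cinner x x = complex_of_real ((norm x)\<^sup>2)"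
proof (rule complex_eqI)
  show "Re (cinner x x) = Re (complex_of_real ((norm x)\<^sup>2))"
    by (metis Re_complex_of_real inner_ell2_def power2_norm_eq_inner)
  show "Im (cinner x x) = Im (complex_of_real ((norm x)\<^sup>2))"
    using arg_cong[OF cinner_commute[of x x], of Im] by simp
qed

lemma norm_cscale [simp]: "norm (cscale c x) = cmod c * norm x"
proof -
  have "(norm (cscale c x))\<^sup>2 = (cmod c * norm x)\<^sup>2"
    by (simp add: norm_ell2_square power_mult_distrib norm_mult infsum_cmult_right')
  then show ?thesis by (simp add: power2_eq_iff_nonneg)
qed

lemma cscale_add_right: "cscale c (x + y) = cscale c x + cscale c y"
  by (rule ell2_eqI) (simp add: distrib_left)

lemma cscale_scaleR: "cscale c (r *\<^sub>R x) = r *\<^sub>R cscale c x"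
  by (rule ell2_eqI) (simp add: scaleR_ell2_def)

lemma cscale_cscale [simp]: "cscale c (cscale d x) = cscale (c * d) x"
  by (rule ell2_eqI) (simp add: mult.assoc)

lemma bounded_linear_cscale: "bounded_linear (cscale c)"
  by (rule bounded_linear_intro[of _ "cmod c"])
     (simp_all add: cscale_add_right cscale_scaleR mult.commute)

lemma cmod_cinner_le: "cmod (cinner x y) \<le> norm x * norm y"
proof -
  define c where "c = (if cinner x y = 0 then 1 else cnj (cinner x y) / cmod (cinner x y))"
  have c: "cmod c = 1" by (simp add: c_def norm_divide)
  have "cinner x (cscale c y) = complex_of_real (cmod (cinner x y))"
  proof (cases "cinner x y = 0")
    case False
    have "cnj (cinner x y) * cinner x y = complex_of_real (cmod (cinner x y) * cmod (cinner x y))"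
      by (metis complex_norm_square mult.commute power2_eq_square)
    then show ?thesis using False by (simp add: c_def)
  qed simp
  then have "cmod (cinner x y) = inner x (cscale c y)"
    by (simp add: inner_ell2_def)
  also have "\<dots> \<le> norm x * norm (cscale c y)" by (rule norm_cauchy_schwarz)
  finally show ?thesis by (simp add: c)
qed

lift_definition ket :: "'a \<Rightarrow> 'a ell2" is "\<lambda>i j. if i = j then 1 else 0"
proof -
  fix i :: 'a
  have "(\<lambda>j. (cmod (if i = j then 1 else 0))\<^sup>2) summable_on {i}" by simp
  then have "(\<lambda>j. (cmod (if i = j then 1 else 0))\<^sup>2) summable_on UNIV"
    using summable_on_cong_neutral[of UNIV "{i}" "\<lambda>j. (cmod (if i = j then 1 else 0))\<^sup>2"
        "\<lambda>j. (cmod (if i = j then 1 else 0))\<^sup>2"] by auto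
  then show "(\<lambda>j. (cmod (if i = j then 1 else 0))\<^sup>2) summable_on UNIV" .
qed

lemma cinner_ket_left [simp]: "cinner (ket i) x = coord x i"
proof -
  have "cinner (ket i) x = (\<Sum>\<^sub>\<infinity>j\<in>{i}. cnj (coord (ket i) j) * coord x j)"
    unfolding cinner_def by (rule infsum_cong_neutral) (auto simp: ket.rep_eq)
  then show ?thesis by (simp add: ket.rep_eq)
qed

lemma cinner_ket_ket: "cinner (ket i) (ket j) = (if i = j then 1 else 0)"
  by (simp add: ket.rep_eq)

lemma ket_expansion: "((\<lambda>i. cscale (coord x i) (ket i)) has_sum x) UNIV"
proof -
  let ?s = "\<lambda>F. \<Sum>i\<in>F. cscale (coord x i) (ket i)"
  have s: "coord (?s F) j = (if j \<in> F then coord x j else 0)" if "finite F" for F j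
    using that by (simp add: coord_sum ket.rep_eq if_distrib[of "\<lambda>u. _ * u"] cong: if_cong)
  have n: "(norm (?s F - x))\<^sup>2 = (norm x)\<^sup>2 - (\<Sum>i\<in>F. (cmod (coord x i))\<^sup>2)" if "finite F" for F
  proof -
    have "(norm (?s F - x))\<^sup>2 = (\<Sum>\<^sub>\<infinity>i\<in>UNIV - F. (cmod (coord x i))\<^sup>2)"
      unfolding norm_ell2_square by (rule infsum_cong_neutral) (auto simp: s that)
    also have "\<dots> = (\<Sum>\<^sub>\<infinity>i. (cmod (coord x i))\<^sup>2) - (\<Sum>\<^sub>\<infinity>i\<in>F. (cmod (coord x i))\<^sup>2)"
      by (rule infsum_Diff) (use that coord_summable in auto)
    finally show ?thesis using that by (simp add: norm_ell2_square)
  qed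
  have "((\<lambda>F. \<Sum>i\<in>F. (cmod (coord x i))\<^sup>2) \<longlongrightarrow> (norm x)\<^sup>2) (finite_subsets_at_top UNIV)"
    using has_sum_infsum[OF coord_summable[of x]] by (simp add: norm_ell2_square has_sum_def)
  from tendsto_diff[OF tendsto_const this, of "(norm x)\<^sup>2"]
  have "((\<lambda>F. (norm x)\<^sup>2 - (\<Sum>i\<in>F. (cmod (coord x i))\<^sup>2)) \<longlongrightarrow> 0) (finite_subsets_at_top UNIV)"
    by simp
  then have "((\<lambda>F. (norm (?s F - x))\<^sup>2) \<longlongrightarrow> 0) (finite_subsets_at_top UNIV)"
    by (rule Lim_transform_eventually) (auto simp: n intro!: eventually_finite_subsets_at_top_weakI)
  from tendsto_real_sqrt[OF this]
  have "((\<lambda>F. norm (?s F - x)) \<longlongrightarrow> 0) (finite_subsets_at_top UNIV)"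
    by simp
  then show ?thesis
    unfolding has_sum_def by (metis LIM_zero_cancel tendsto_norm_zero_iff)
qed


section \<open>C*-algebras of operators\<close>

(* The library type of bounded operators only knows real scalars, so
   complex linearity is imposed separately; the operator norm is the same. *)
definition complex_linear :: "('a ell2 \<Rightarrow>\<^sub>L 'a ell2) \<Rightarrow> bool" where
  "complex_linear T \<longleftrightarrow> (\<forall>c x. T (cscale c x) = cscale c (T x))"

lift_definition cscale_blinfun :: "complex \<Rightarrow> 'a ell2 \<Rightarrow>\<^sub>L 'a ell2" is cscale
  by (rule bounded_linear_cscale)

definition op_cscale :: "complex \<Rightarrow> ('a ell2 \<Rightarrow>\<^sub>L 'a ell2) \<Rightarrow> ('a ell2 \<Rightarrow>\<^sub>L 'a ell2)" where
  "op_cscale c T = cscale_blinfun c o\<^sub>L T"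

definition op_adj :: "('a ell2 \<Rightarrow>\<^sub>L 'a ell2) \<Rightarrow> ('a ell2 \<Rightarrow>\<^sub>L 'a ell2)" where
  "op_adj T = (THE S. \<forall>x y. cinner (T x) y = cinner x (blinfun_apply S y))"

lemma op_adj_unique:
  fixes S T :: "'a ell2 \<Rightarrow>\<^sub>L 'a ell2"
  assumes "\<And>x y. cinner (T x) y = cinner x (S y)"
  shows "op_adj T = S"
  unfolding op_adj_def
proof (rule the_equality)
  fix S' assume S': "\<forall>x y. cinner (T x) y = cinner x (blinfun_apply S' y)"
  show "S' = S"
  proof (intro blinfun_eqI ell2_eqI)
    fix y i
    show "coord (S' y) i = coord (S y) i"
      using assms[of "ket i" y] S'[rule_format, of "ket i" y] by simp
  qed
qed (use assms in simp)

(* Operators that are only real linear have no adjoint for cinner in general. *)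
lemma op_adj:
  assumes T: "complex_linear T"
  shows "cinner (T x) y = cinner x (op_adj T y)" and "complex_linear (op_adj T)"
proof -
  define g where "g = (\<lambda>y i. cinner (T (ket i)) y)"
  have fin: "(\<Sum>i\<in>F. (cmod (g y i))\<^sup>2) \<le> (norm T * norm y)\<^sup>2" if F: "finite F" for F y
  proof -
    let ?s = "\<Sum>i\<in>F. (cmod (g y i))\<^sup>2"
    let ?v = "\<Sum>i\<in>F. cscale (g y i) (ket i)"
    have c: "coord ?v j = (if j \<in> F then g y j else 0)" for j
      using F by (simp add: coord_sum ket.rep_eq if_distrib[of "\<lambda>u. _ * u"] cong: if_cong)
    have "(norm ?v)\<^sup>2 = (\<Sum>\<^sub>\<infinity>i\<in>F. (cmod (g y i))\<^sup>2)"
      unfolding norm_ell2_square by (rule infsum_cong_neutral) (auto simp: c)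
    then have nv: "(norm ?v)\<^sup>2 = ?s" using F by simp
    have "cinner (T ?v) y = (\<Sum>i\<in>F. cinner (T (cscale (g y i) (ket i))) y)"
      using F
      by (induction F rule: finite_induct)
         (simp_all add: blinfun.add_right cinner_add_left, simp add: cinner_def)
    also have "\<dots> = (\<Sum>i\<in>F. complex_of_real ((cmod (g y i))\<^sup>2))"
      using T by (intro sum.cong)
        (auto simp: complex_linear_def g_def complex_norm_square mult.commute simp del: of_real_power)
    finally have "cinner (T ?v) y = complex_of_real ?s" by (simp only: of_real_sum)
    then have "?s = cmod (cinner (T ?v) y)"
      by (simp only: norm_of_real abs_of_nonneg sum_nonneg zero_le_power2)
    also have "\<dots> \<le> norm (T ?v) * norm y" by (rule cmod_cinner_le)
    also have "\<dots> \<le> (norm T * norm ?v) * norm y"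
      by (intro mult_right_mono norm_blinfun) auto
    finally have "norm ?v * norm ?v \<le> (norm T * norm y) * norm ?v"
      unfolding nv[symmetric] by (simp add: power2_eq_square algebra_simps)
    then have "norm ?v \<le> norm T * norm y"
      by (cases "norm ?v = 0") (auto simp: mult_le_cancel_right)
    then show ?thesis unfolding nv[symmetric] by (intro power_mono) auto
  qed
  have mem: "(\<lambda>i. (cmod (g y i))\<^sup>2) summable_on UNIV" for y
    by (rule nonneg_bdd_above_summable_on) (use fin in \<open>auto simp: bdd_above_def\<close>)
  define h where "h y = Abs_ell2 (g y)" for y
  have h: "coord (h y) i = g y i" for y i
    unfolding h_def using mem by (simp add: Abs_ell2_inverse)
  have hl: "bounded_linear h"
  proof (rule bounded_linear_intro)
    show "h (x + y) = h x + h y" for x y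
      by (rule ell2_eqI) (simp add: h g_def cinner_add_right)
    show "h (r *\<^sub>R x) = r *\<^sub>R h x" for r x
      by (rule ell2_eqI) (simp add: h g_def scaleR_ell2_def)
    show "norm (h y) \<le> norm y * norm T" for y
      by (rule norm_ell2_leI) (use fin in \<open>auto simp: h mult.commute\<close>)
  qed
  have adj: "cinner (T x) y = cinner x (h y)" for x y
  proof -
    have bl: "bounded_linear (\<lambda>x. cinner x z)" for z :: "'a ell2"
      by (rule bounded_linear_intro[of _ "norm z"])
         (simp_all add: cinner_add_left scaleR_ell2_def cmod_cinner_le scaleR_conv_of_real)
    have "((\<lambda>i. cinner (T (cscale (coord x i) (ket i))) y) has_sum cinner (T x) y) UNIV"
      by (rule has_sum_bounded_linear[OF bounded_linear_compose[OF bl blinfun.bounded_linear_right]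
          ket_expansion, unfolded o_def])
    moreover have "((\<lambda>i. cinner (cscale (coord x i) (ket i)) (h y)) has_sum cinner x (h y)) UNIV"
      by (rule has_sum_bounded_linear[OF bl ket_expansion, unfolded o_def])
    moreover have "cinner (T (cscale (coord x i) (ket i))) y = cinner (cscale (coord x i) (ket i)) (h y)" for i
      using T by (simp add: complex_linear_def h g_def)
    ultimately show ?thesis by (simp add: has_sum_unique)
  qed
  have eq: "op_adj T = Blinfun h"
    by (rule op_adj_unique) (simp add: bounded_linear_Blinfun_apply[OF hl] adj)
  show "cinner (T x) y = cinner x (op_adj T y)"
    by (simp add: eq bounded_linear_Blinfun_apply[OF hl] adj)
  show "complex_linear (op_adj T)"
    unfolding eq complex_linear_def
    by (auto simp: bounded_linear_Blinfun_apply[OF hl] h g_def intro!: ell2_eqI)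
qed

definition subalgebra :: "('a ell2 \<Rightarrow>\<^sub>L 'a ell2) set \<Rightarrow> bool" where
  "subalgebra A \<longleftrightarrow> A \<subseteq> Collect complex_linear \<and> 0 \<in> A \<and>
     (\<forall>S\<in>A. \<forall>T\<in>A. S + T \<in> A \<and> S o\<^sub>L T \<in> A) \<and> (\<forall>c. \<forall>T\<in>A. op_cscale c T \<in> A)"

definition cstar_subalgebra :: "('a ell2 \<Rightarrow>\<^sub>L 'a ell2) set \<Rightarrow> bool" where
  "cstar_subalgebra A \<longleftrightarrow> subalgebra A \<and> (\<forall>T\<in>A. op_adj T \<in> A) \<and> closed A"

definition commutative_ops :: "('a ell2 \<Rightarrow>\<^sub>L 'a ell2) set \<Rightarrow> bool" where
  "commutative_ops A \<longleftrightarrow> (\<forall>S\<in>A. \<forall>T\<in>A. S o\<^sub>L T = T o\<^sub>L S)"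

(* No unit is adjoined. *)
definition cstar_generated :: "('a ell2 \<Rightarrow>\<^sub>L 'a ell2) set \<Rightarrow> ('a ell2 \<Rightarrow>\<^sub>L 'a ell2) set" where
  "cstar_generated G = \<Inter>{A. cstar_subalgebra A \<and> G \<subseteq> A}"

lemma cstar_subalgebra_complex_linear: "cstar_subalgebra (Collect (complex_linear :: ('a ell2 \<Rightarrow>\<^sub>L 'a ell2) \<Rightarrow> bool))"
proof -
  have "closed (Collect (complex_linear :: ('a ell2 \<Rightarrow>\<^sub>L 'a ell2) \<Rightarrow> bool))"
    unfolding complex_linear_def
    by (intro closed_Collect_all closed_Collect_eq
        bounded_linear.continuous_on[OF bounded_linear_cscale] continuous_intros)
  then show ?thesis
    unfolding cstar_subalgebra_def subalgebra_def
    by (auto simp: op_adj(2))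
       (auto simp: complex_linear_def op_cscale_def cscale_blinfun.rep_eq blinfun.bilinear_simps
         cscale_add_right mult.commute intro: ell2_eqI)
qed

lemma cstar_subalgebra_generated:
  assumes "G \<subseteq> Collect complex_linear"
  shows "cstar_subalgebra (cstar_generated G)" and "G \<subseteq> cstar_generated G"
proof -
  have "cstar_generated G \<subseteq> Collect complex_linear"
    unfolding cstar_generated_def using assms cstar_subalgebra_complex_linear by blast
  moreover have "closed (cstar_generated G)"
    unfolding cstar_generated_def by (auto simp: cstar_subalgebra_def)
  ultimately show "cstar_subalgebra (cstar_generated G)"
    unfolding cstar_subalgebra_def subalgebra_def by (auto simp: cstar_generated_def
      cstar_subalgebra_def subalgebra_def)
  show "G \<subseteq> cstar_generated G" by (auto simp: cstar_generated_def)
qed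


section \<open>Monotone Fock space and the monotone algebra\<close>

(* The empty index stands for the vacuum vector. *)
typedef mono_index = "{is :: int list. sorted_wrt (<) is}"
  morphisms idx Abs_mono_index
  by (rule exI[of _ "[]"]) simp

lemma sorted_idx: "sorted_wrt (<) (idx s)"
  using idx[of s] by simp

type_synonym fock = "mono_index ell2"

(* The coordinates of a_i x; annihil_ket gives the equivalent action on basis vectors. *)
definition annihil_coord :: "int \<Rightarrow> fock \<Rightarrow> mono_index \<Rightarrow> complex" where
  "annihil_coord i x t =
     (if sorted_wrt (<) (i # idx t) then coord x (Abs_mono_index (i # idx t)) else 0)"

lemma annihil_coord_sum_le:
  assumes "finite F"
  shows "(\<Sum>t\<in>F. (cmod (annihil_coord i x t))\<^sup>2) \<le> (norm x)\<^sup>2"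
proof -
  let ?F = "{t\<in>F. sorted_wrt (<) (i # idx t)}" and ?f = "\<lambda>t. Abs_mono_index (i # idx t)"
  have inj: "inj_on ?f ?F"
    by (rule inj_onI)
       (metis (mono_tags, lifting) Abs_mono_index_inject idx_inject list.inject mem_Collect_eq)
  have "(\<Sum>t\<in>F. (cmod (annihil_coord i x t))\<^sup>2) = (\<Sum>t\<in>?F. (cmod (coord x (?f t)))\<^sup>2)"
    using assms by (intro sum.mono_neutral_cong_right) (auto simp: annihil_coord_def)
  also have "\<dots> = (\<Sum>s\<in>?f ` ?F. (cmod (coord x s))\<^sup>2)"
    by (simp only: sum.reindex[OF inj] o_def)
  also have "\<dots> \<le> (norm x)\<^sup>2" using assms by (intro sum_coord_le) auto
  finally show ?thesis .
qed

definition annihil_fun :: "int \<Rightarrow> fock \<Rightarrow> fock" where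
  "annihil_fun i x = Abs_ell2 (annihil_coord i x)"

lemma coord_annihil_fun: "coord (annihil_fun i x) = annihil_coord i x"
proof -
  have "(\<lambda>t. (cmod (annihil_coord i x t))\<^sup>2) summable_on UNIV"
    by (rule nonneg_bdd_above_summable_on)
       (use annihil_coord_sum_le in \<open>auto simp: bdd_above_def\<close>)
  then show ?thesis by (simp add: annihil_fun_def Abs_ell2_inverse)
qed

lift_definition annihil :: "int \<Rightarrow> fock \<Rightarrow>\<^sub>L fock" is annihil_fun
proof (rule bounded_linear_intro)
  fix i and x y :: fock and r :: real
  show "annihil_fun i (x + y) = annihil_fun i x + annihil_fun i y"
    by (rule ell2_eqI) (simp add: coord_annihil_fun annihil_coord_def)
  show "annihil_fun i (r *\<^sub>R x) = r *\<^sub>R annihil_fun i x"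
    by (rule ell2_eqI) (simp add: coord_annihil_fun annihil_coord_def scaleR_ell2_def)
  show "norm (annihil_fun i x) \<le> norm x * 1"
    by (rule norm_ell2_leI) (simp_all add: coord_annihil_fun annihil_coord_sum_le)
qed

lemma annihil_ket:
  "annihil i (ket s) =
     (case idx s of [] \<Rightarrow> 0 | j # t \<Rightarrow> if i = j then ket (Abs_mono_index t) else 0)"
proof (rule ell2_eqI)
  fix t
  have "s = Abs_mono_index (i # idx t) \<longleftrightarrow> idx s = i # idx t" if "sorted_wrt (<) (i # idx t)"
    using that by (metis (mono_tags, lifting) Abs_mono_index_inverse idx_inverse mem_Collect_eq)
  moreover have "Abs_mono_index u = t \<longleftrightarrow> u = idx t" if "idx s = j # u" for j u
    using that sorted_idx[of s]
    by (metis (mono_tags, lifting) Abs_mono_index_inverse idx_inverse mem_Collect_eq sorted_wrt.simps(2))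
  ultimately show "coord (annihil i (ket s)) t = coord (case idx s of [] \<Rightarrow> 0
      | j # t \<Rightarrow> if i = j then ket (Abs_mono_index t) else 0) t"
    using sorted_idx[of s]
    by (auto simp: annihil.rep_eq coord_annihil_fun annihil_coord_def ket.rep_eq split: list.split)
qed

lemma complex_linear_annihil: "complex_linear (annihil i)"
  unfolding complex_linear_def
  by (auto simp: annihil.rep_eq coord_annihil_fun annihil_coord_def intro!: ell2_eqI)

(* The universal C*-algebra of the monotone rules, in its faithful representation
   on the monotone Fock space. *)
definition monotone_alg :: "(fock \<Rightarrow>\<^sub>L fock) set" where
  "monotone_alg = cstar_generated (insert id_blinfun (range annihil))"

definition monotone_ideal :: "(fock \<Rightarrow>\<^sub>L fock) set" where
  "monotone_ideal = cstar_generated (range annihil)"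

lemma monotone_ideal_subset: "monotone_ideal \<subseteq> monotone_alg"
  unfolding monotone_ideal_def monotone_alg_def cstar_generated_def by blast

definition local_alg :: "nat \<Rightarrow> (fock \<Rightarrow>\<^sub>L fock) set" where
  "local_alg n = cstar_generated (annihil ` {i. \<bar>i\<bar> \<le> int n})"

definition local_basis :: "nat \<Rightarrow> mono_index set" where
  "local_basis n = {s. \<forall>j\<in>set (idx s). \<bar>j\<bar> \<le> int n}"

(* local_alg n leaves V_n invariant and acts faithfully on it, so an element is
   determined by its matrix on V_n. The matrix of T restricted to V_n, the span of the ket s with s in local_basis n,
   has the entries cinner (ket s) (T (ket t)). *)
definition local_diag :: "nat \<Rightarrow> (fock \<Rightarrow>\<^sub>L fock) set" where
  "local_diag n = {T \<in> local_alg n.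
     \<forall>s\<in>local_basis n. \<forall>t\<in>local_basis n. s \<noteq> t \<longrightarrow> cinner (ket s) (T (ket t)) = 0}"

definition diag_alg :: "(fock \<Rightarrow>\<^sub>L fock) set" where
  "diag_alg = closure (\<Union>n. local_diag n)"

end

theory Submission
  imports Defs
begin

text \<open>Cutting an increasing index sequence at \<open>n\<close> identifies the part of the Fock space where
  \<open>local_alg n\<close> acts with a tensor product, so that \<open>local_alg n\<close> is spanned by matrix units
  \<open>e\<^sub>u\<^sub>v\<close> acting on the first tensor factor. Hence an operator in \<open>local_diag n\<close> is diagonal in the
  whole Fock basis, not only on \<open>V\<^sub>n\<close>. The diagonal part of an element of \<open>local_alg n\<close> lies in
  \<open>local_diag n\<close>, and taking diagonal parts is norm contractive and fixes diagonal operators;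
  approximating from the local algebras, \<open>diag_alg\<close> is exactly the set of diagonal operators in
  \<open>monotone_ideal\<close>. Finally, an operator commuting with all \<open>e\<^sub>s\<^sub>s\<close> is diagonal, since any two basis
  vectors are separated by such a projection.\<close>

section \<open>Operators on the sequence space\<close>

lemma cstar_subalgebraD:
  assumes "cstar_subalgebra A"
  shows "T \<in> A \<Longrightarrow> complex_linear T" and "0 \<in> A"
    and "S \<in> A \<Longrightarrow> T \<in> A \<Longrightarrow> S + T \<in> A" and "S \<in> A \<Longrightarrow> T \<in> A \<Longrightarrow> S o\<^sub>L T \<in> A"
    and "T \<in> A \<Longrightarrow> op_cscale c T \<in> A" and "T \<in> A \<Longrightarrow> op_adj T \<in> A" and "closed A"
  using assms unfolding cstar_subalgebra_def subalgebra_def by auto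

lemmas complex_linear_closed =
  cstar_subalgebraD[OF cstar_subalgebra_complex_linear, unfolded mem_Collect_eq]

lemma cstar_subalgebra_sum:
  assumes "cstar_subalgebra A" "\<And>i. i \<in> I \<Longrightarrow> f i \<in> A"
  shows "sum f I \<in> A"
  using assms(2) by (induction I rule: infinite_finite_induct)
    (auto intro: cstar_subalgebraD(2,3)[OF assms(1)])

lemma complex_linear_sum: "(\<And>i. i \<in> I \<Longrightarrow> complex_linear (f i)) \<Longrightarrow> complex_linear (sum f I)"
  using cstar_subalgebra_sum[OF cstar_subalgebra_complex_linear, of I f] by simp

lemma op_cscale_apply [simp]: "op_cscale c T x = cscale c (T x)"
  by (simp add: op_cscale_def cscale_blinfun.rep_eq)

lemma op_cscale_add_right: "op_cscale c (S + T) = op_cscale c S + op_cscale c T"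
  by (intro blinfun_eqI) (simp add: blinfun.bilinear_simps cscale_add_right)

lemma op_cscale_add_left: "op_cscale (c + d) T = op_cscale c T + op_cscale d T"
  by (intro blinfun_eqI ell2_eqI) (simp add: blinfun.bilinear_simps distrib_right)

lemma op_cscale_zero_left [simp]: "op_cscale 0 T = 0"
  by (intro blinfun_eqI ell2_eqI) simp

lemma op_cscale_zero_right [simp]: "op_cscale c 0 = 0"
  by (intro blinfun_eqI ell2_eqI) simp

lemma op_cscale_one [simp]: "op_cscale 1 T = T"
  by (intro blinfun_eqI ell2_eqI) simp

lemma op_cscale_minus_one: "op_cscale (- 1) T = - T"
  by (intro blinfun_eqI ell2_eqI) (simp add: blinfun.bilinear_simps)

lemma cstar_subalgebra_diff:
  assumes A: "cstar_subalgebra A" and "S \<in> A" "T \<in> A"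
  shows "S - T \<in> A"
  using cstar_subalgebraD(3)[OF A assms(2) cstar_subalgebraD(5)[OF A assms(3), of "- 1"]]
  by (simp add: op_cscale_minus_one)

lemma op_cscale_mult: "op_cscale c (op_cscale d T) = op_cscale (c * d) T"
  by (intro blinfun_eqI ell2_eqI) (simp add: mult.assoc)

lemma op_cscale_sum: "op_cscale c (sum f I) = (\<Sum>i\<in>I. op_cscale c (f i))"
  by (induction I rule: infinite_finite_induct) (simp_all add: op_cscale_add_right)

lemma compose_op_cscale:
  assumes "complex_linear S"
  shows "op_cscale c S o\<^sub>L op_cscale d T = op_cscale (c * d) (S o\<^sub>L T)"
  using assms by (intro blinfun_eqI) (simp add: complex_linear_def)

text \<open>Matrix entries vary continuously with the operator in norm, so any set cut out by
  equations between entries is closed.\<close>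

lemma continuous_on_coord_apply:
  "continuous_on UNIV (\<lambda>T :: 'a ell2 \<Rightarrow>\<^sub>L 'a ell2. coord (T x) i)"
proof -
  have "bounded_linear (\<lambda>x. coord x i)" for i :: 'a
    by (rule bounded_linear_intro[of _ 1])
       (simp_all add: scaleR_ell2_def scaleR_conv_of_real norm_coord_le)
  then show ?thesis
    using linear_continuous_on[OF bounded_linear_compose[OF _ blinfun.bounded_linear_left]] by blast
qed

text \<open>Composed with the continuity of entries, this gives the continuity of
  \<open>compress n\<close>.\<close>

lemma continuous_on_op_cscale_left: "continuous_on UNIV (\<lambda>c. op_cscale c T)"
proof -
  have "bounded_linear (\<lambda>c. op_cscale c T)"
  proof (rule bounded_linear_intro)
    show "op_cscale (r *\<^sub>R c) T = r *\<^sub>R op_cscale c T" for r c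
      by (intro blinfun_eqI ell2_eqI) (simp add: scaleR_ell2_def scaleR_conv_of_real blinfun.bilinear_simps)
    show "norm (op_cscale c T) \<le> norm c * norm T" for c
      by (rule norm_blinfun_bound) (auto simp: mult.assoc intro!: mult_left_mono norm_blinfun)
  qed (rule op_cscale_add_left)
  then show ?thesis by (rule linear_continuous_on)
qed

section \<open>Adjoints of complex linear operators\<close>

lemma op_adj_right:
  assumes "complex_linear T"
  shows "cinner (op_adj T x) y = cinner x (T y)"
  using op_adj(1)[OF assms, of y x] by (metis cinner_commute)

lemma coord_op_adj_ket:
  assumes "complex_linear T"
  shows "coord (op_adj T (ket s)) t = cnj (coord (T (ket t)) s)"
  using op_adj(1)[OF assms, of "ket t" "ket s"] cinner_commute[of "T (ket t)" "ket s"] by simp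

text \<open>Moving \<open>T\<close> onto the basis vector reduces a coordinate of \<open>T x\<close>
  to the adjoint at \<open>ket s\<close>, which is known entrywise; no series expansion of
  \<open>x\<close> is involved.\<close>

lemma coord_eq_cinner_adj:
  assumes "complex_linear T"
  shows "coord (T x) s = cinner (op_adj T (ket s)) x"
  using op_adj_right[OF assms, of "ket s" x] by simp

text \<open>Equal values on basis vectors give equal matrix entries, hence equal adjoints on basis
  vectors, and these determine every coordinate of \<open>S x\<close> and
  \<open>T x\<close>.\<close>

lemma complex_linear_eqI:
  assumes "complex_linear S" "complex_linear T" "\<And>t. S (ket t) = T (ket t)"
  shows "S = T"
proof (intro blinfun_eqI ell2_eqI)
  fix x s
  have "op_adj S (ket s) = op_adj T (ket s)"
    by (rule ell2_eqI) (simp add: coord_op_adj_ket assms)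
  then show "coord (S x) s = coord (T x) s"
    by (simp add: coord_eq_cinner_adj assms)
qed

lemma op_adj_zero [simp]: "op_adj 0 = (0 :: 'a ell2 \<Rightarrow>\<^sub>L 'a ell2)"
  by (rule op_adj_unique) (simp add: cinner_def)

lemma op_adj_add:
  assumes "complex_linear S" "complex_linear T"
  shows "op_adj (S + T) = op_adj S + op_adj T"
  by (rule op_adj_unique)
     (simp add: blinfun.bilinear_simps cinner_add_left cinner_add_right op_adj(1)[OF assms(1)]
       op_adj(1)[OF assms(2)])

lemma op_adj_cscale:
  assumes "complex_linear T"
  shows "op_adj (op_cscale c T) = op_cscale (cnj c) (op_adj T)"
  by (rule op_adj_unique) (simp add: op_adj(1)[OF assms])

lemma op_adj_compose:
  assumes "complex_linear S" "complex_linear T"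
  shows "op_adj (S o\<^sub>L T) = op_adj T o\<^sub>L op_adj S"
  by (rule op_adj_unique) (simp add: op_adj(1)[OF assms(1)] op_adj(1)[OF assms(2)])

lemma op_adj_op_adj:
  assumes "complex_linear T"
  shows "op_adj (op_adj T) = T"
  by (rule op_adj_unique) (rule op_adj_right[OF assms])

lemma op_adj_sum:
  assumes "\<And>i. i \<in> I \<Longrightarrow> complex_linear (f i)"
  shows "op_adj (sum f I) = (\<Sum>i\<in>I. op_adj (f i))"
  using assms
proof (induction I rule: infinite_finite_induct)
  case (insert i I)
  then show ?case by (simp add: op_adj_add complex_linear_sum)
qed simp_all

text \<open>With \<open>z\<close> the image of \<open>y\<close> under the adjoint, the square of
  \<open>norm z\<close> is the modulus of \<open>cinner (T z) y\<close>; Cauchy-Schwarz bounds this,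
  and one factor \<open>norm z\<close> cancels.\<close>

lemma norm_op_adj_le:
  assumes "complex_linear T"
  shows "norm (op_adj T) \<le> norm T"
proof (rule norm_blinfun_bound)
  fix y
  let ?z = "op_adj T y"
  have "(norm ?z)\<^sup>2 = cmod (cinner ?z ?z)"
    by (simp add: cinner_self norm_power)
  also have "\<dots> = cmod (cinner (T ?z) y)"
    by (simp add: op_adj(1)[OF assms])
  also have "\<dots> \<le> norm (T ?z) * norm y" by (rule cmod_cinner_le)
  also have "\<dots> \<le> (norm T * norm ?z) * norm y"
    by (intro mult_right_mono norm_blinfun) auto
  finally have "norm ?z * norm ?z \<le> (norm T * norm y) * norm ?z"
    by (simp add: power2_eq_square algebra_simps)
  then show "norm ?z \<le> norm T * norm y"
    by (cases "norm ?z = 0") (auto simp: mult_le_cancel_right)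
qed simp

lemma tendsto_op_adj:
  assumes "\<And>k. complex_linear (X k)" "complex_linear T" "X \<longlonglongrightarrow> T"
  shows "(\<lambda>k. op_adj (X k)) \<longlonglongrightarrow> op_adj T"
proof -
  have le: "norm (op_adj (X k) - op_adj T) \<le> norm (X k - T)" for k
  proof -
    have "op_adj (- T) = - op_adj T"
      using op_adj_cscale[OF assms(2), of "- 1"] by (simp add: op_cscale_minus_one)
    moreover have "complex_linear (- T)"
      using complex_linear_closed(5)[OF assms(2), of "- 1"] by (simp add: op_cscale_minus_one)
    ultimately have "op_adj (X k - T) = op_adj (X k) - op_adj T"
      using op_adj_add[OF assms(1)[of k], of "- T"] by simp
    moreover have "complex_linear (X k - T)"
      using cstar_subalgebra_diff[OF cstar_subalgebra_complex_linear, of "X k" T] assms by simp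
    ultimately show ?thesis using norm_op_adj_le by metis
  qed
  have lim: "(\<lambda>k. norm (X k - T)) \<longlonglongrightarrow> 0"
    using assms(3) by (simp add: LIM_zero tendsto_norm_zero)
  have "\<forall>\<^sub>F k in sequentially. norm (op_adj (X k) - op_adj T) \<le> norm (X k - T)"
    using le by (rule always_eventually[OF allI])
  then have "(\<lambda>k. op_adj (X k) - op_adj T) \<longlonglongrightarrow> 0"
    using lim by (rule Lim_null_comparison)
  then show ?thesis by (rule LIM_zero_cancel)
qed

text \<open>All operations are norm continuous along sequences in \<open>U\<close>. This is applied
  to the union of the local algebras.\<close>

lemma cstar_subalgebra_closure:
  assumes sub: "subalgebra U" and adj: "\<And>T. T \<in> U \<Longrightarrow> op_adj T \<in> U"
  shows "cstar_subalgebra (closure U)"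
proof -
  have cl: "closure U \<subseteq> Collect complex_linear"
    by (rule closure_minimal)
       (use sub complex_linear_closed(7) in \<open>auto simp: subalgebra_def\<close>)
  \<comment> \<open>One limit argument for all operations but the adjoint: scalar multiplication is
    treated as a binary operation ignoring its second argument. The continuity of the adjoint holds
    only among complex linear operators, so it is handled apart.\<close>
  have bin: "f S T \<in> closure U"
    if prems: "S \<in> closure U" "T \<in> closure U" "\<And>S T. S \<in> U \<Longrightarrow> T \<in> U \<Longrightarrow> f S T \<in> U"
      "\<And>X Y S T. X \<longlonglongrightarrow> S \<Longrightarrow> Y \<longlonglongrightarrow> T \<Longrightarrow> (\<lambda>k. f (X k) (Y k)) \<longlonglongrightarrow> f S T" for f S T
  proof -
    obtain X Y where "\<And>k. X k \<in> U" "X \<longlonglongrightarrow> S" "\<And>k. Y k \<in> U" "Y \<longlonglongrightarrow> T"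
      using prems(1,2) unfolding closure_sequential by blast
    with prems(3,4) show ?thesis
      unfolding closure_sequential by (intro exI[of _ "\<lambda>k. f (X k) (Y k)"]) simp
  qed
  show ?thesis
    unfolding cstar_subalgebra_def subalgebra_def
  proof (intro conjI ballI allI)
    show "closure U \<subseteq> Collect complex_linear" by fact
    show "0 \<in> closure U" using sub closure_subset by (auto simp: subalgebra_def)
    show "closed (closure U)" by simp
    fix S T assume ST: "S \<in> closure U" "T \<in> closure U"
    show "S + T \<in> closure U"
      by (rule bin[OF ST]) (use sub in \<open>auto simp: subalgebra_def intro: tendsto_add\<close>)
    show "S o\<^sub>L T \<in> closure U"
      by (rule bin[OF ST, where f = "(o\<^sub>L)"])
         (use sub in \<open>auto simp: subalgebra_def
           intro: bounded_bilinear.tendsto[OF bounded_bilinear_blinfun_compose]\<close>)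
  next
    fix c T assume T: "T \<in> closure U"
    show "op_cscale c T \<in> closure U"
      by (rule bin[OF T T, where f = "\<lambda>S T. op_cscale c S"])
         (use sub in \<open>auto simp: subalgebra_def op_cscale_def
           intro: bounded_bilinear.tendsto[OF bounded_bilinear_blinfun_compose tendsto_const]\<close>)
  next
    fix T assume T: "T \<in> closure U"
    then obtain X where X: "\<And>k. X k \<in> U" "X \<longlonglongrightarrow> T" unfolding closure_sequential by blast
    have "complex_linear (X k)" for k using X(1) sub by (auto simp: subalgebra_def)
    moreover have "complex_linear T" using T cl by blast
    ultimately have "(\<lambda>k. op_adj (X k)) \<longlonglongrightarrow> op_adj T" using X(2) tendsto_op_adj by blast
    then show "op_adj T \<in> closure U"
      unfolding closure_sequential using X(1) adj by (intro exI[of _ "\<lambda>k. op_adj (X k)"]) simp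
  qed
qed


section \<open>Diagonal operators\<close>

definition diagonal_op :: "('a ell2 \<Rightarrow>\<^sub>L 'a ell2) \<Rightarrow> bool" where
  "diagonal_op T \<longleftrightarrow> complex_linear T \<and> (\<forall>s t. s \<noteq> t \<longrightarrow> coord (T (ket t)) s = 0)"

lemma diagonal_op_adj:
  assumes "diagonal_op T"
  shows "diagonal_op (op_adj T)"
  using assms by (auto simp: diagonal_op_def coord_op_adj_ket op_adj(2))

text \<open>The adjoint multiplies each \<open>ket s\<close> by a scalar; pairing with
  \<open>x\<close> shows that \<open>T\<close> multiplies coordinatewise by its diagonal
  entries.\<close>

lemma diagonal_op_coord:
  assumes "diagonal_op T"
  shows "coord (T x) s = coord (T (ket s)) s * coord x s"
proof -
  have T: "complex_linear T" using assms by (simp add: diagonal_op_def)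
  have "op_adj T (ket s) = cscale (cnj (coord (T (ket s)) s)) (ket s)"
    using assms by (intro ell2_eqI) (auto simp: diagonal_op_def coord_op_adj_ket ket.rep_eq)
  then show ?thesis by (simp add: coord_eq_cinner_adj[OF T, of x s])
qed

lemma diagonal_op_commute:
  assumes "diagonal_op S" "diagonal_op T"
  shows "S o\<^sub>L T = T o\<^sub>L S"
proof (intro blinfun_eqI ell2_eqI)
  fix x s
  show "coord ((S o\<^sub>L T) x) s = coord ((T o\<^sub>L S) x) s"
    using diagonal_op_coord[OF assms(1), of "T x" s] diagonal_op_coord[OF assms(2), of "S x" s]
      diagonal_op_coord[OF assms(1), of x s] diagonal_op_coord[OF assms(2), of x s] by simp
qed

lemma cstar_subalgebra_diagonal: "cstar_subalgebra (Collect diagonal_op)"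
  unfolding cstar_subalgebra_def subalgebra_def
proof (intro conjI ballI allI)
  show "Collect diagonal_op \<subseteq> Collect complex_linear" by (auto simp: diagonal_op_def)
  show "(0 :: 'a ell2 \<Rightarrow>\<^sub>L 'a ell2) \<in> Collect diagonal_op"
    by (simp add: diagonal_op_def complex_linear_closed(2))
  have "closed (\<Inter>s. \<Inter>t\<in>- {s}. {T :: 'a ell2 \<Rightarrow>\<^sub>L 'a ell2. coord (T (ket t)) s = 0})"
    by (intro closed_INT ballI closed_Collect_eq continuous_on_coord_apply continuous_on_const)
  moreover have "Collect diagonal_op = Collect complex_linear \<inter>
      (\<Inter>s. \<Inter>t\<in>- {s}. {T :: 'a ell2 \<Rightarrow>\<^sub>L 'a ell2. coord (T (ket t)) s = 0})"
    by (auto simp: diagonal_op_def)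
  ultimately show "closed (Collect (diagonal_op :: ('a ell2 \<Rightarrow>\<^sub>L 'a ell2) \<Rightarrow> bool))"
    using complex_linear_closed(7) by auto
  fix S T :: "'a ell2 \<Rightarrow>\<^sub>L 'a ell2"
  assume ST: "S \<in> Collect diagonal_op" "T \<in> Collect diagonal_op"
  then show "S + T \<in> Collect diagonal_op"
    by (auto simp: diagonal_op_def complex_linear_closed(3) blinfun.bilinear_simps)
  have "coord (S (T (ket t))) s = 0" if "s \<noteq> t" for s t
    using that diagonal_op_coord[of S "T (ket t)" s] ST by (simp add: diagonal_op_def)
  then show "S o\<^sub>L T \<in> Collect diagonal_op"
    using ST by (auto simp: diagonal_op_def complex_linear_closed(4))
qed (auto simp: diagonal_op_def complex_linear_closed(5) diagonal_op_adj[unfolded diagonal_op_def])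

text \<open>A coordinatewise multiplication is bounded by any bound on its multipliers. Together
  with \<open>cmod_coord_ket_le\<close> this makes passing to the diagonal contractive.\<close>

lemma norm_diagonal_op_le:
  assumes "diagonal_op T" "\<And>s. cmod (coord (T (ket s)) s) \<le> b"
  shows "norm T \<le> b"
proof (rule norm_blinfun_bound)
  show b: "0 \<le> b" using assms(2)[of undefined] norm_ge_zero order_trans by blast
  fix x
  show "norm (T x) \<le> b * norm x"
  proof (rule norm_ell2_leI)
    fix F :: "'a set" assume "finite F"
    have "(\<Sum>i\<in>F. (cmod (coord (T x) i))\<^sup>2) \<le> (\<Sum>i\<in>F. b\<^sup>2 * (cmod (coord x i))\<^sup>2)"
      unfolding diagonal_op_coord[OF assms(1), of x] norm_mult power_mult_distrib
      by (intro sum_mono mult_right_mono power_mono assms(2)) auto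
    also have "\<dots> \<le> b\<^sup>2 * (norm x)\<^sup>2"
      unfolding sum_distrib_left[symmetric]
      using sum_coord_le[OF \<open>finite F\<close>, of x] by (simp add: mult_left_mono)
    finally show "(\<Sum>i\<in>F. (cmod (coord (T x) i))\<^sup>2) \<le> (b * norm x)\<^sup>2"
      by (simp add: power_mult_distrib)
  qed (use b in simp)
qed

lemma cmod_coord_ket_le:
  fixes T :: "'a ell2 \<Rightarrow>\<^sub>L 'a ell2"
  shows "cmod (coord (T (ket t)) s) \<le> norm T"
proof -
  have "(norm (ket t))\<^sup>2 = 1"
    using cinner_self[of "ket t"] by (simp add: ket.rep_eq flip: of_real_power)
  then have "norm (ket t) = 1" by (simp add: power2_eq_1_iff flip: of_real_power) (smt (verit) norm_ge_zero)
  then show ?thesis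
    using norm_coord_le[of "T (ket t)" s] norm_blinfun[of T "ket t"] by simp
qed


section \<open>Splitting basis indices\<close>

text \<open>An index splits at \<open>n\<close> into its entries \<open>\<le> n\<close> and its entries \<open>> n\<close>. The local algebra
  acts on the first part only, and only if that part has no entry below \<open>-n\<close>.\<close>

definition indices_above :: "nat \<Rightarrow> mono_index set" where
  "indices_above n = {t. \<forall>j\<in>set (idx t). int n < j}"

definition low :: "nat \<Rightarrow> mono_index \<Rightarrow> mono_index" where
  "low n s = Abs_mono_index (filter (\<lambda>j. j \<le> int n) (idx s))"

definition high :: "nat \<Rightarrow> mono_index \<Rightarrow> mono_index" where
  "high n s = Abs_mono_index (filter (\<lambda>j. int n < j) (idx s))"

text \<open>Meaningful only if the concatenation is increasing; otherwise
  \<open>Abs_mono_index\<close> gives an unspecified index.\<close>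

definition join :: "mono_index \<Rightarrow> mono_index \<Rightarrow> mono_index" where
  "join s t = Abs_mono_index (idx s @ idx t)"

definition vacuum :: mono_index where
  "vacuum = Abs_mono_index []"

lemma idx_Abs: "sorted_wrt (<) is \<Longrightarrow> idx (Abs_mono_index is) = is"
  by (simp add: Abs_mono_index_inverse)

lemma idx_vacuum [simp]: "idx vacuum = []"
  by (simp add: vacuum_def idx_Abs)

lemma idx_low [simp]: "idx (low n s) = filter (\<lambda>j. j \<le> int n) (idx s)"
  by (simp add: low_def idx_Abs sorted_wrt_filter sorted_idx)

lemma idx_high [simp]: "idx (high n s) = filter (\<lambda>j. int n < j) (idx s)"
  by (simp add: high_def idx_Abs sorted_wrt_filter sorted_idx)

lemma idx_eqI: "idx s = idx t \<Longrightarrow> s = t"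
  by (simp add: idx_inject)

lemma high_indices_above [simp]: "high n s \<in> indices_above n"
  by (simp add: indices_above_def)

lemma sorted_join:
  assumes "u \<in> local_basis n" "t \<in> indices_above n"
  shows "sorted_wrt (<) (idx u @ idx t)"
  using assms by (fastforce simp: sorted_wrt_append sorted_idx local_basis_def indices_above_def)

lemma idx_join [simp]:
  assumes "u \<in> local_basis n" "t \<in> indices_above n"
  shows "idx (join u t) = idx u @ idx t"
  unfolding join_def by (rule idx_Abs) (rule sorted_join[OF assms])

lemma low_join [simp]:
  assumes "u \<in> local_basis n" "t \<in> indices_above n"
  shows "low n (join u t) = u"
proof (rule idx_eqI)
  have "filter (\<lambda>j. j \<le> int n) (idx u) = idx u" "filter (\<lambda>j. j \<le> int n) (idx t) = []"
    using assms by (auto simp: filter_id_conv filter_empty_conv local_basis_def indices_above_def)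
  then show "idx (low n (join u t)) = idx u" by (simp add: idx_join[OF assms])
qed

lemma high_join [simp]:
  assumes "u \<in> local_basis n" "t \<in> indices_above n"
  shows "high n (join u t) = t"
proof (rule idx_eqI)
  have "filter (\<lambda>j. int n < j) (idx u) = []" "filter (\<lambda>j. int n < j) (idx t) = idx t"
    using assms by (auto simp: filter_id_conv filter_empty_conv local_basis_def indices_above_def)
  then show "idx (high n (join u t)) = idx t" by (simp add: idx_join[OF assms])
qed

text \<open>In an increasing list the entries up to \<open>n\<close> precede those above
  \<open>n\<close>, so concatenating the two filtered lists restores it. This covers every index,
  even one with entries below \<open>-n\<close>.\<close>

lemma join_low_high [simp]: "join (low n s) (high n s) = s"
proof -
  have "filter (\<lambda>j. j \<le> m) xs @ filter (\<lambda>j. m < j) xs = xs" if "sorted_wrt (<) xs" for xs and m :: int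
    using that
  proof (induction xs)
    case (Cons x xs)
    show ?case
    proof (cases "x \<le> m")
      case False
      then have "m < y" if "y \<in> set xs" for y using Cons.prems that by force
      then have "filter (\<lambda>j. j \<le> m) xs = []" "filter (\<lambda>j. m < j) xs = xs"
        by (force simp: filter_empty_conv filter_id_conv)+
      with False show ?thesis by simp
    qed (use Cons in simp)
  qed simp
  from this[OF sorted_idx] show ?thesis by (simp add: join_def idx_inverse)
qed

lemma low_local_basis [simp]: "s \<in> local_basis n \<Longrightarrow> low n s = s"
  by (rule idx_eqI) (auto simp: filter_id_conv local_basis_def)

lemma high_local_basis [simp]: "s \<in> local_basis n \<Longrightarrow> high n s = vacuum"
  by (rule idx_eqI) (auto simp: filter_empty_conv local_basis_def)

lemma join_vacuum [simp]: "join u vacuum = u"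
  by (simp add: join_def idx_inverse)

lemma finite_local_basis: "finite (local_basis n)"
proof -
  have "finite {xs. set xs \<subseteq> {-int n..int n} \<and> distinct xs}"
    by (rule finite_subset_distinct) simp
  moreover have "idx ` local_basis n \<subseteq> {xs. set xs \<subseteq> {-int n..int n} \<and> distinct xs}"
    using sorted_idx by (force simp: local_basis_def strict_sorted_iff)
  ultimately show ?thesis
    by (rule finite_subset[rotated, THEN finite_imageD]) (auto intro: inj_onI idx_eqI)
qed


section \<open>Matrix units of the local algebras\<close>

definition create :: "int \<Rightarrow> fock \<Rightarrow>\<^sub>L fock" where
  "create i = op_adj (annihil i)"

lemma complex_linear_create: "complex_linear (create i)"
  unfolding create_def by (rule op_adj(2)) (rule complex_linear_annihil)

lemma create_ket:
  "create i (ket t) =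
     (if sorted_wrt (<) (i # idx t) then ket (Abs_mono_index (i # idx t)) else 0)"
  by (rule ell2_eqI)
     (auto simp: create_def coord_op_adj_ket complex_linear_annihil annihil.rep_eq
       coord_annihil_fun annihil_coord_def ket.rep_eq)

text \<open>The product of the \<open>n\<close>-th annihilator and its adjoint is the projection onto the span of the
  basis vectors with all indices above \<open>n\<close>, that is, the matrix unit at the vacuum.\<close>

definition raise :: "nat \<Rightarrow> int list \<Rightarrow> fock \<Rightarrow>\<^sub>L fock" where
  "raise n us = foldr (\<lambda>i T. create i o\<^sub>L T) us (annihil (int n) o\<^sub>L create (int n))"

lemma complex_linear_raise: "complex_linear (raise n us)"
  unfolding raise_def
  by (induction us)
     (auto intro: complex_linear_closed(4) complex_linear_create complex_linear_annihil)

text \<open>Each creator requires the lengthened list to be increasing. Tails of increasing lists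
  are increasing, so only the condition on the full list survives.\<close>

lemma raise_ket:
  "raise n us (ket t) =
     (if t \<in> indices_above n \<and> sorted_wrt (<) (us @ idx t) then ket (Abs_mono_index (us @ idx t)) else 0)"
proof (induction us)
  case Nil
  show ?case
    by (auto simp: raise_def create_ket annihil_ket idx_Abs sorted_idx indices_above_def idx_inverse)
next
  case (Cons i us)
  have "raise n (i # us) (ket t) = create i (raise n us (ket t))" by (simp add: raise_def)
  then show ?case unfolding Cons
    by (auto simp: create_ket idx_Abs)
qed

lemma raise_basis_ket:
  assumes "u \<in> local_basis n"
  shows "raise n (idx u) (ket t) = (if t \<in> indices_above n then ket (join u t) else 0)"
  using sorted_join[OF assms] by (simp add: raise_ket join_def)

text \<open>Raising by \<open>v\<close> carries \<open>ket t\<close> to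
  \<open>ket (join v t)\<close> injectively for \<open>t\<close> in \<open>indices_above n\<close>;
  its adjoint undoes this on the range and vanishes on the other basis vectors.\<close>

lemma raise_adj_ket:
  assumes "v \<in> local_basis n"
  shows "op_adj (raise n (idx v)) (ket s) = (if low n s = v then ket (high n s) else 0)"
proof (rule ell2_eqI)
  fix t
  have "t \<in> indices_above n \<and> join v t = s \<longleftrightarrow> low n s = v \<and> high n s = t"
    using assms by auto
  then show "coord (op_adj (raise n (idx v)) (ket s)) t
      = coord (if low n s = v then ket (high n s) else 0) t"
    by (auto simp: coord_op_adj_ket complex_linear_raise raise_basis_ket[OF assms] ket.rep_eq)
qed

text \<open>For \<open>u\<close> and \<open>v\<close> in \<open>local_basis n\<close> this is the
  elementary matrix at \<open>(u, v)\<close> tensored with the identity on high parts: the adjoint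
  strips the low part \<open>v\<close>, then \<open>u\<close> is put in front.\<close>

definition matrix_unit :: "nat \<Rightarrow> mono_index \<Rightarrow> mono_index \<Rightarrow> fock \<Rightarrow>\<^sub>L fock" where
  "matrix_unit n u v = raise n (idx u) o\<^sub>L op_adj (raise n (idx v))"

lemma complex_linear_matrix_unit: "complex_linear (matrix_unit n u v)"
  unfolding matrix_unit_def
  by (intro complex_linear_closed(4) op_adj(2) complex_linear_raise)

lemma matrix_unit_ket:
  assumes "u \<in> local_basis n" "v \<in> local_basis n"
  shows "matrix_unit n u v (ket s) = (if low n s = v then ket (join u (high n s)) else 0)"
  by (simp add: matrix_unit_def raise_adj_ket raise_basis_ket assms)

lemma op_adj_matrix_unit: "op_adj (matrix_unit n u v) = matrix_unit n v u"
  unfolding matrix_unit_def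
  by (simp add: op_adj_compose op_adj_op_adj complex_linear_raise op_adj(2))

lemma op_adj_sum_matrix_unit:
  "op_adj (\<Sum>u\<in>A. \<Sum>v\<in>B. op_cscale (c u v) (matrix_unit n u v))
     = (\<Sum>u\<in>A. \<Sum>v\<in>B. op_cscale (cnj (c u v)) (matrix_unit n v u))"
  by (simp add: op_adj_sum op_adj_cscale op_adj_matrix_unit complex_linear_matrix_unit
    complex_linear_closed(5) complex_linear_sum)

lemma matrix_unit_compose:
  assumes "u \<in> local_basis n" "v \<in> local_basis n" "u' \<in> local_basis n" "v' \<in> local_basis n"
  shows "matrix_unit n u v o\<^sub>L matrix_unit n u' v' = (if v = u' then matrix_unit n u v' else 0)"
  using assms
  by (intro complex_linear_eqI complex_linear_closed(4) complex_linear_matrix_unit)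
     (auto simp: matrix_unit_ket complex_linear_matrix_unit complex_linear_closed(2))

lemma coord_matrix_unit:
  assumes "u \<in> local_basis n" "v \<in> local_basis n" "u' \<in> local_basis n" "v' \<in> local_basis n"
  shows "coord (matrix_unit n u v (ket v')) u' = (if u = u' \<and> v = v' then 1 else 0)"
  using assms by (auto simp: matrix_unit_ket ket.rep_eq)

text \<open>Reads off the matrix of \<open>T\<close> on the finite-dimensional space spanned by
  \<open>local_basis n\<close> and rebuilds an operator on the whole Fock space from these
  entries.\<close>

definition compress :: "nat \<Rightarrow> (fock \<Rightarrow>\<^sub>L fock) \<Rightarrow> fock \<Rightarrow>\<^sub>L fock" where
  "compress n T =
     (\<Sum>u\<in>local_basis n. \<Sum>v\<in>local_basis n. op_cscale (coord (T (ket v)) u) (matrix_unit n u v))"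

lemma compress_add: "compress n (S + T) = compress n S + compress n T"
  by (simp add: compress_def blinfun.bilinear_simps op_cscale_add_left sum.distrib)

lemma compress_cscale: "compress n (op_cscale c T) = op_cscale c (compress n T)"
  by (simp add: compress_def op_cscale_sum op_cscale_mult)

lemma compress_matrix_unit:
  assumes "u \<in> local_basis n" "v \<in> local_basis n"
  shows "compress n (matrix_unit n u v) = matrix_unit n u v"
proof -
  have "compress n (matrix_unit n u v) = (\<Sum>u'\<in>local_basis n. \<Sum>v'\<in>local_basis n.
      if v = v' then if u = u' then matrix_unit n u' v' else 0 else 0)"
    unfolding compress_def by (intro sum.cong) (auto simp: coord_matrix_unit assms)
  also have "\<dots> = matrix_unit n u v"
    using assms by (simp add: finite_local_basis)
  finally show ?thesis .
qed

text \<open>Being fixed by \<open>compress n\<close> is a closed condition, so this linear span is norm closed.\<close>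

definition matrix_span :: "nat \<Rightarrow> (fock \<Rightarrow>\<^sub>L fock) set" where
  "matrix_span n = {T. complex_linear T \<and> T = compress n T}"

lemma matrix_span_eq: "T \<in> matrix_span n \<Longrightarrow> compress n T = T"
  by (simp add: matrix_span_def)

lemma matrix_span_complex_linear: "T \<in> matrix_span n \<Longrightarrow> complex_linear T"
  by (simp add: matrix_span_def)

lemma matrix_span_zero: "0 \<in> matrix_span n"
  by (simp add: matrix_span_def compress_def complex_linear_closed(2))

lemma matrix_span_add: "S \<in> matrix_span n \<Longrightarrow> T \<in> matrix_span n \<Longrightarrow> S + T \<in> matrix_span n"
  by (auto simp: matrix_span_def compress_add intro: complex_linear_closed(3))

lemma matrix_span_cscale: "T \<in> matrix_span n \<Longrightarrow> op_cscale c T \<in> matrix_span n"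
  by (auto simp: matrix_span_def compress_cscale intro: complex_linear_closed(5))

lemma matrix_unit_span:
  "u \<in> local_basis n \<Longrightarrow> v \<in> local_basis n \<Longrightarrow> matrix_unit n u v \<in> matrix_span n"
  by (simp add: matrix_span_def compress_matrix_unit complex_linear_matrix_unit)

lemma matrix_span_sum: "(\<And>i. i \<in> I \<Longrightarrow> f i \<in> matrix_span n) \<Longrightarrow> sum f I \<in> matrix_span n"
  by (induction I rule: infinite_finite_induct) (auto intro: matrix_span_zero matrix_span_add)

lemma matrix_span_compose:
  assumes "S \<in> matrix_span n" "T \<in> matrix_span n"
  shows "S o\<^sub>L T \<in> matrix_span n"
proof -
  note sums = bounded_bilinear.sum_left[OF bounded_bilinear_blinfun_compose]
    bounded_bilinear.sum_right[OF bounded_bilinear_blinfun_compose]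
  have mem: "matrix_unit n u v o\<^sub>L matrix_unit n u' v' \<in> matrix_span n"
    if "u \<in> local_basis n" "v \<in> local_basis n" "u' \<in> local_basis n" "v' \<in> local_basis n" for u v u' v'
    using that by (simp add: matrix_unit_compose matrix_unit_span matrix_span_zero)
  have "compress n S o\<^sub>L compress n T \<in> matrix_span n"
    unfolding compress_def sums compose_op_cscale[OF complex_linear_matrix_unit]
    by (intro matrix_span_sum matrix_span_cscale mem)
  then show ?thesis by (simp add: matrix_span_eq assms)
qed

text \<open>Once the generators are known to lie in it, minimality of the generated algebra places
  all of \<open>local_alg n\<close> in the span.\<close>

lemma cstar_subalgebra_matrix_span: "cstar_subalgebra (matrix_span n)"
  unfolding cstar_subalgebra_def subalgebra_def
proof (intro conjI ballI allI)
  show "matrix_span n \<subseteq> Collect complex_linear" using matrix_span_complex_linear by blast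
  have "closed {T. T = compress n T}"
    unfolding compress_def by (intro closed_Collect_eq continuous_intros
        continuous_on_compose2[OF continuous_on_op_cscale_left continuous_on_coord_apply]) auto
  then show "closed (matrix_span n)"
    unfolding matrix_span_def Collect_conj_eq
    by (rule closed_Int[OF complex_linear_closed(7)])
  fix T assume T: "T \<in> matrix_span n"
  have "op_adj (compress n T) \<in> matrix_span n"
    unfolding compress_def op_adj_sum_matrix_unit
    by (intro matrix_span_sum matrix_span_cscale matrix_unit_span)
  then show "op_adj T \<in> matrix_span n" by (simp add: matrix_span_eq T)
qed (auto intro: matrix_span_zero matrix_span_add matrix_span_cscale matrix_span_compose)

text \<open>The product of \<open>annihil i\<close> with the projection at \<open>v\<close> is the
  matrix unit from \<open>v\<close> to \<open>v\<close> without its first entry if that entry is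
  \<open>i\<close>, and zero otherwise. Summing over \<open>v\<close> recovers
  \<open>annihil i\<close>.\<close>

lemma annihil_matrix_span:
  assumes "\<bar>i\<bar> \<le> int n"
  shows "annihil i \<in> matrix_span n"
proof -
  note cl = complex_linear_closed(4)[OF complex_linear_annihil complex_linear_matrix_unit]
  have mem: "annihil i o\<^sub>L matrix_unit n v v \<in> matrix_span n" if v: "v \<in> local_basis n" for v
  proof (cases "\<exists>us. idx v = i # us")
    case True
    then obtain us where us: "idx v = i # us" by blast
    define u where "u = Abs_mono_index us"
    have idx_u: "idx u = us"
      unfolding u_def using sorted_idx[of v] us by (intro idx_Abs) simp
    have u: "u \<in> local_basis n" using v by (simp add: local_basis_def us idx_u)
    have "annihil i (ket (join v (high n s))) = ket (join u (high n s))" for s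
      using v by (simp add: annihil_ket us idx_u join_def[of u])
    then have "annihil i o\<^sub>L matrix_unit n v v = matrix_unit n u v"
      using u v by (intro complex_linear_eqI cl complex_linear_matrix_unit)
        (simp add: matrix_unit_ket)
    with u v show ?thesis by (simp add: matrix_unit_span)
  next
    case False
    have "annihil i (ket (join v (high n s))) = 0" for s
    proof (cases "idx v")
      case Nil
      \<comment> \<open>With an empty low part, the first entry of the joined index exceeds
        \<open>n\<close>, hence also \<open>i\<close>.\<close>
      have "j \<noteq> i" if "idx (high n s) = j # t" for j t
        using that high_indices_above[of n s] assms by (auto simp: indices_above_def simp del: idx_high high_indices_above)
      then show ?thesis using v Nil by (auto simp: annihil_ket simp del: idx_high split: list.split)
    next
      case (Cons j us)
      then show ?thesis using v False by (auto simp: annihil_ket)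
    qed
    then have "annihil i o\<^sub>L matrix_unit n v v = 0"
      using v by (intro complex_linear_eqI cl complex_linear_closed(2))
        (simp add: matrix_unit_ket)
    then show ?thesis by (simp add: matrix_span_zero)
  qed
  have sum_mem: "(\<Sum>v\<in>local_basis n. annihil i o\<^sub>L matrix_unit n v v) \<in> matrix_span n"
    by (intro matrix_span_sum mem)
  have "annihil i = (\<Sum>v\<in>local_basis n. annihil i o\<^sub>L matrix_unit n v v)"
  proof (rule complex_linear_eqI)
    show "complex_linear (\<Sum>v\<in>local_basis n. annihil i o\<^sub>L matrix_unit n v v)"
      by (rule matrix_span_complex_linear[OF sum_mem])
    fix s
    have "(\<Sum>v\<in>local_basis n. annihil i o\<^sub>L matrix_unit n v v) (ket s)
        = (\<Sum>v\<in>local_basis n. if low n s = v then annihil i (ket s) else 0)"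
      unfolding blinfun.sum_left by (intro sum.cong) (auto simp: matrix_unit_ket)
    also have "\<dots> = (if low n s \<in> local_basis n then annihil i (ket s) else 0)"
      by (simp add: finite_local_basis)
    also have "\<dots> = annihil i (ket s)"
    proof (cases "low n s \<in> local_basis n")
      case False
      \<comment> \<open>The projections miss only indices with an entry below \<open>-n\<close>. The
        first entry is then below \<open>-n\<close> too, so it is not \<open>i\<close> and
        \<open>annihil i\<close> kills the vector.\<close>
      then obtain k where k: "k \<in> set (idx s)" "k < - int n" by (auto simp: local_basis_def)
      then obtain j us where us: "idx s = j # us" by (cases "idx s") auto
      then have "j \<le> k" using k sorted_idx[of s] by auto
      then have "i \<noteq> j" using k assms by auto
      with False us show ?thesis by (simp add: annihil_ket)
    qed simp
    finally show "annihil i (ket s) = (\<Sum>v\<in>local_basis n. annihil i o\<^sub>L matrix_unit n v v) (ket s)"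
      by simp
  qed (rule complex_linear_annihil)
  with sum_mem show ?thesis by simp
qed

section \<open>The local algebras and their density in the ideal\<close>

lemma cstar_subalgebra_local_alg: "cstar_subalgebra (local_alg n)"
  and annihil_local_alg: "\<bar>i\<bar> \<le> int n \<Longrightarrow> annihil i \<in> local_alg n"
  unfolding local_alg_def
  using cstar_subalgebra_generated[of "annihil ` {i. \<bar>i\<bar> \<le> int n}"] complex_linear_annihil by auto

lemma cstar_subalgebra_monotone_ideal: "cstar_subalgebra monotone_ideal"
  unfolding monotone_ideal_def
  by (rule cstar_subalgebra_generated) (auto simp: complex_linear_annihil)

lemma cstar_generated_least: "cstar_subalgebra A \<Longrightarrow> G \<subseteq> A \<Longrightarrow> cstar_generated G \<subseteq> A"
  unfolding cstar_generated_def by blast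

lemma cstar_generated_mono: "G \<subseteq> H \<Longrightarrow> cstar_generated G \<subseteq> cstar_generated H"
  unfolding cstar_generated_def by blast

lemma local_alg_subset_matrix_span: "local_alg n \<subseteq> matrix_span n"
  unfolding local_alg_def
  by (intro cstar_generated_least cstar_subalgebra_matrix_span) (auto intro: annihil_matrix_span)

lemma local_alg_subset_ideal: "local_alg n \<subseteq> monotone_ideal"
  unfolding local_alg_def monotone_ideal_def by (intro cstar_generated_mono) auto

lemma local_alg_mono: "m \<le> n \<Longrightarrow> local_alg m \<subseteq> local_alg n"
  unfolding local_alg_def by (intro cstar_generated_mono) auto

lemma raise_local_alg:
  assumes "set us \<subseteq> {i. \<bar>i\<bar> \<le> int n}"
  shows "raise n us \<in> local_alg n"
  using assms unfolding raise_def create_def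
  by (induction us)
     (auto intro!: cstar_subalgebraD(4,6)[OF cstar_subalgebra_local_alg] annihil_local_alg)

lemma matrix_unit_local_alg:
  assumes "u \<in> local_basis n" "v \<in> local_basis n"
  shows "matrix_unit n u v \<in> local_alg n"
  unfolding matrix_unit_def
  using assms by (auto simp: local_basis_def
    intro!: cstar_subalgebraD(4,6)[OF cstar_subalgebra_local_alg] raise_local_alg)

text \<open>The local algebras increase with \<open>n\<close>, so their union is a star-algebra; it
  contains every generator, and its closure is a C*-algebra.\<close>

lemma monotone_ideal_subset_closure: "monotone_ideal \<subseteq> closure (\<Union>n. local_alg n)"
  unfolding monotone_ideal_def
proof (intro cstar_generated_least cstar_subalgebra_closure)
  show "subalgebra (\<Union>n. local_alg n)"
    unfolding subalgebra_def
  proof (intro conjI ballI allI)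
    show "(\<Union>n. local_alg n) \<subseteq> Collect complex_linear"
      using cstar_subalgebraD(1)[OF cstar_subalgebra_local_alg] by auto
    show "0 \<in> (\<Union>n. local_alg n)"
      using cstar_subalgebraD(2)[OF cstar_subalgebra_local_alg] by auto
    show "op_cscale c T \<in> (\<Union>n. local_alg n)" if "T \<in> (\<Union>n. local_alg n)" for c T
      using that cstar_subalgebraD(5)[OF cstar_subalgebra_local_alg] by blast
    fix S T assume "S \<in> (\<Union>n. local_alg n)" "T \<in> (\<Union>n. local_alg n)"
    then obtain m n where "S \<in> local_alg m" "T \<in> local_alg n" by blast
    then have ST: "S \<in> local_alg (max m n)" "T \<in> local_alg (max m n)"
      using local_alg_mono max.cobounded1 max.cobounded2 by blast+
    show "S + T \<in> (\<Union>n. local_alg n)" "S o\<^sub>L T \<in> (\<Union>n. local_alg n)"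
      using cstar_subalgebraD(3,4)[OF cstar_subalgebra_local_alg ST] by (auto intro: UN_I)
  qed
  show "op_adj T \<in> (\<Union>n. local_alg n)" if "T \<in> (\<Union>n. local_alg n)" for T
    using that cstar_subalgebraD(6)[OF cstar_subalgebra_local_alg] by blast
  have "annihil i \<in> local_alg (nat \<bar>i\<bar>)" for i by (rule annihil_local_alg) simp
  then show "range annihil \<subseteq> closure (\<Union>n. local_alg n)"
    using closure_subset by blast
qed


section \<open>The diagonal subalgebra\<close>

lemma diagonal_op_matrix_unit:
  assumes "u \<in> local_basis n"
  shows "diagonal_op (matrix_unit n u u)"
  using assms
  by (auto simp: diagonal_op_def complex_linear_matrix_unit matrix_unit_ket ket.rep_eq)

definition diagonal_part :: "nat \<Rightarrow> (fock \<Rightarrow>\<^sub>L fock) \<Rightarrow> fock \<Rightarrow>\<^sub>L fock" where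
  "diagonal_part n T = (\<Sum>u\<in>local_basis n. op_cscale (coord (T (ket u)) u) (matrix_unit n u u))"

lemma diagonal_op_diagonal_part: "diagonal_op (diagonal_part n T)"
proof -
  have "diagonal_part n T \<in> Collect diagonal_op"
    unfolding diagonal_part_def
    by (intro cstar_subalgebra_sum[OF cstar_subalgebra_diagonal] cstar_subalgebraD(5)[OF cstar_subalgebra_diagonal])
       (simp add: diagonal_op_matrix_unit)
  then show ?thesis by simp
qed

lemma diagonal_part_local_diag: "diagonal_part n T \<in> local_diag n"
proof -
  have "diagonal_part n T \<in> local_alg n"
    unfolding diagonal_part_def
    by (intro cstar_subalgebra_sum[OF cstar_subalgebra_local_alg] cstar_subalgebraD(5)[OF cstar_subalgebra_local_alg])
       (simp add: matrix_unit_local_alg)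
  then show ?thesis
    using diagonal_op_diagonal_part by (simp add: local_diag_def diagonal_op_def)
qed

text \<open>For \<open>u\<close> different from \<open>v\<close>, the matrix unit changes the low
  part, so it fixes no basis vector and contributes nothing to the diagonal. Hence equality holds at
  every index \<open>s\<close>, although \<open>diagonal_part\<close> reads only the entries on
  \<open>local_basis n\<close>.\<close>

lemma coord_diagonal_part:
  assumes "T \<in> matrix_span n"
  shows "coord (diagonal_part n T (ket s)) s = coord (T (ket s)) s"
proof -
  have inner: "(\<Sum>v\<in>local_basis n. coord (T (ket v)) u * coord (matrix_unit n u v (ket s)) s)
      = coord (T (ket u)) u * coord (matrix_unit n u u (ket s)) s"
    if u: "u \<in> local_basis n" for u
  proof -
    have "coord (matrix_unit n u v (ket s)) s = 0" if v: "v \<in> local_basis n" "v \<noteq> u" for v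
    proof -
      have "join u (high n s) \<noteq> s" if "low n s = v"
        using that v(2) low_join[OF u high_indices_above, of s] by metis
      then show ?thesis using u v by (simp add: matrix_unit_ket ket.rep_eq)
    qed
    then show ?thesis
      using u by (subst sum.remove[OF finite_local_basis u]) (auto intro: sum.neutral)
  qed
  have "coord (T (ket s)) s = coord (compress n T (ket s)) s"
    by (simp add: matrix_span_eq assms)
  also have "\<dots> = coord (diagonal_part n T (ket s)) s"
    by (simp add: compress_def diagonal_part_def blinfun.sum_left coord_sum inner)
  finally show ?thesis by simp
qed

text \<open>The definition of \<open>local_diag\<close> constrains only the matrix on
  \<open>local_basis n\<close>. These entries are the coefficients in the matrix unit expansion, so
  only diagonal units remain, and they are diagonal on the whole Fock space.\<close>

lemma local_diag_diagonal:
  assumes "T \<in> local_diag n"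
  shows "diagonal_op T"
proof -
  have "T \<in> matrix_span n" using assms local_alg_subset_matrix_span by (auto simp: local_diag_def)
  then have "T = compress n T" by (simp add: matrix_span_eq)
  also have "\<dots> = (\<Sum>u\<in>local_basis n. \<Sum>v\<in>local_basis n.
      if u = v then op_cscale (coord (T (ket v)) u) (matrix_unit n u v) else 0)"
    unfolding compress_def using assms by (intro sum.cong) (auto simp: local_diag_def)
  also have "\<dots> = diagonal_part n T"
    by (simp add: diagonal_part_def finite_local_basis)
  finally show ?thesis using diagonal_op_diagonal_part by metis
qed

lemma diag_alg_eq: "diag_alg = monotone_ideal \<inter> Collect diagonal_op"
proof (rule antisym)
  have "closed (monotone_ideal \<inter> Collect diagonal_op)"
    using cstar_subalgebraD(7)[OF cstar_subalgebra_monotone_ideal]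
      cstar_subalgebraD(7)[OF cstar_subalgebra_diagonal] by (rule closed_Int)
  moreover have "local_diag n \<subseteq> monotone_ideal" for n
    using local_alg_subset_ideal by (auto simp: local_diag_def)
  ultimately show "diag_alg \<subseteq> monotone_ideal \<inter> Collect diagonal_op"
    unfolding diag_alg_def using local_diag_diagonal by (intro closure_minimal) auto
next
  show "monotone_ideal \<inter> Collect diagonal_op \<subseteq> diag_alg"
  proof
    fix T assume T: "T \<in> monotone_ideal \<inter> Collect diagonal_op"
    then have T_closure: "T \<in> closure (\<Union>n. local_alg n)"
      using monotone_ideal_subset_closure by blast
    have "\<exists>S\<in>\<Union>n. local_diag n. dist S T < e" if e: "e > 0" for e
    proof -
      obtain n R where R: "R \<in> local_alg n" "dist R T < e"
        using T_closure e unfolding closure_approachable by blast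
      let ?S = "diagonal_part n R"
      \<comment> \<open>Both operators are diagonal, and \<open>?S\<close> has the diagonal of
        \<open>R\<close>. So the entries of the difference are diagonal entries of
        \<open>R - T\<close>, each bounded by \<open>norm (R - T)\<close>.\<close>
      have "diagonal_op (?S - T)"
        using T diagonal_op_diagonal_part[of n R]
          cstar_subalgebra_diff[OF cstar_subalgebra_diagonal, of ?S T] by simp
      then have "norm (?S - T) \<le> norm (R - T)"
      proof (rule norm_diagonal_op_le)
        fix s
        have "coord ((?S - T) (ket s)) s = coord ((R - T) (ket s)) s"
          using R(1) local_alg_subset_matrix_span[of n]
          by (simp add: blinfun.bilinear_simps coord_diagonal_part subsetD)
        then show "cmod (coord ((?S - T) (ket s)) s) \<le> norm (R - T)"
          using cmod_coord_ket_le by metis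
      qed
      then have "dist ?S T < e" using R(2) by (simp add: dist_norm)
      then show ?thesis using diagonal_part_local_diag[of n R] by blast
    qed
    then show "T \<in> diag_alg" unfolding diag_alg_def closure_approachable by blast
  qed
qed

section \<open>The commutant of the diagonal algebra\<close>

lemma matrix_unit_diag_alg:
  assumes "u \<in> local_basis n"
  shows "matrix_unit n u u \<in> diag_alg"
  using subsetD[OF local_alg_subset_ideal matrix_unit_local_alg[OF assms assms]]
    diagonal_op_matrix_unit[OF assms] by (simp add: diag_alg_eq)

lemma local_basis_exhaust: "\<exists>n. s \<in> local_basis n \<and> t \<in> local_basis n"
proof -
  obtain b where "\<forall>x\<in>(\<lambda>j. nat \<bar>j\<bar>) ` set (idx s @ idx t). x \<le> b"
    using finite_nat_set_iff_bounded_le finite_imageI finite_set by metis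
  then show ?thesis by (intro exI[of _ b]) (auto simp: local_basis_def nat_le_iff)
qed

lemma diagonal_op_if_commute:
  assumes T: "complex_linear T" and comm: "\<And>S. S \<in> diag_alg \<Longrightarrow> S o\<^sub>L T = T o\<^sub>L S"
  shows "diagonal_op T"
  unfolding diagonal_op_def
proof (intro conjI allI impI T)
  fix s t :: mono_index
  assume "s \<noteq> t"
  obtain n where n: "s \<in> local_basis n" "t \<in> local_basis n" using local_basis_exhaust by blast
  let ?E = "matrix_unit n s s"
  \<comment> \<open>The projection \<open>?E\<close> preserves the coordinate at \<open>s\<close>
    and kills \<open>ket t\<close>, because \<open>t\<close> is its own low part and differs from
    \<open>s\<close>; commuting \<open>?E\<close> past \<open>T\<close> makes the entry
    vanish.\<close>
  have "coord (T (ket t)) s = coord (?E (T (ket t))) s"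
    using diagonal_op_coord[OF diagonal_op_matrix_unit[OF n(1)], of "T (ket t)" s]
    by (simp add: coord_matrix_unit n)
  also have "?E (T (ket t)) = T (?E (ket t))"
    using comm[OF matrix_unit_diag_alg[OF n(1)]] by (metis blinfun_apply_blinfun_compose)
  also have "\<dots> = 0" using n \<open>s \<noteq> t\<close> by (auto simp: matrix_unit_ket)
  finally show "coord (T (ket t)) s = 0" by simp
qed

theorem proposition3p10:
  shows "cstar_subalgebra diag_alg \<and> commutative_ops diag_alg \<and> diag_alg \<subseteq> monotone_ideal \<and>
    (\<forall>E. subalgebra E \<and> commutative_ops E \<and> E \<subseteq> monotone_ideal \<and> diag_alg \<subseteq> E \<longrightarrow> E = diag_alg)"
proof (intro conjI allI impI)
  show "cstar_subalgebra diag_alg"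
    using cstar_subalgebra_monotone_ideal cstar_subalgebra_diagonal
    unfolding diag_alg_eq cstar_subalgebra_def subalgebra_def by auto
  show "commutative_ops diag_alg"
    unfolding commutative_ops_def diag_alg_eq using diagonal_op_commute by auto
  show "diag_alg \<subseteq> monotone_ideal" by (simp add: diag_alg_eq)
  fix E assume E: "subalgebra E \<and> commutative_ops E \<and> E \<subseteq> monotone_ideal \<and> diag_alg \<subseteq> E"
  \<comment> \<open>Since \<open>E\<close> is commutative and contains \<open>diag_alg\<close>, each
    of its elements commutes with all of \<open>diag_alg\<close>.\<close>
  have "diagonal_op T" if "T \<in> E" for T
    using E that by (intro diagonal_op_if_commute) (auto simp: subalgebra_def commutative_ops_def)
  then show "E = diag_alg" using E by (auto simp: diag_alg_eq)
qed

end
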